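(* Let $T=\{1,\dots,m\}$, let $a_t\in\mathbb{R}^n$ ($t\in T$) and $c_1,\dots,c_q\in\mathbb{R}^n$ be fixed, and let $\mathcal{F}$, $\mathcal{S}$, $\mathcal{E}_{\mathcal{F}}$ be the feasible set mapping, the nondominated solution mapping and the epigraphical feasible set mapping of the parameterized linear multiobjective problem (see context). Put $C:=\mathrm{cone}\{c_1,\dots,c_q\}$. Let $(\overline{b},\overline{x})\in\mathrm{gph}\,\mathcal{E}_{\mathcal{F}}$. Then $$\partial\mathcal{F}(\overline{b},\overline{x})=\bigcup_{c\in C,\ \|c\|_*=1}\Big\{y\in\mathbb{R}^T\ \Big|\ \langle y,b-\overline{b}\rangle\le\langle c,x-\overline{x}\rangle\ \text{ for all }(b,x)\in\mathrm{gph}\,\mathcal{S}\Big\}.$$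
   Context: $\mathbb{R}^n$ carries an arbitrary norm $\|\cdot\|$ with dual norm $\|\cdot\|_*$; $\mathbb{R}^T$ carries the supremum norm. For $b=(b_t)_{t\in T}\in\mathbb{R}^T$: $\mathcal{F}(b):=\{x\in\mathbb{R}^n:\langle a_t,x\rangle\le b_t,\ t\in T\}$. $\mathcal{S}(b)$ is the set of all $x\in\mathcal{F}(b)$ for which there is no $y\in\mathcal{F}(b)$ with $\langle c_i,y\rangle\le\langle c_i,x\rangle$ for all $i=1,\dots,q$ and $\langle c_{i_0},y\rangle<\langle c_{i_0},x\rangle$ for some $i_0$. For a set $\Omega\subset\mathbb{R}^n$, $\Omega^\circ:=\{y\in\mathbb{R}^n:\langle y,x\rangle\ge0\ \text{for all }x\in\Omega\}$; $\mathrm{cone}$ denotes the convex conic hull. $\mathcal{E}_{\mathcal{F}}(b):=\mathcal{F}(b)+\Theta$ with $\Theta:=\{c_1,\dots,c_q\}^\circ$. The graph of a set-valued mapping $\mathcal{M}$ is $\mathrm{gph}\,\mathcal{M}=\{(y,z): z\in\mathcal{M}(y)\}$. For a convex set $\Omega$ and $\overline{w}\in\Omega$, $N(\overline{w};\Omega)=\{w^*:\langle w^*,w-\overline{w}\rangle\le0\ \forall w\in\Omega\}$. For a set-valued mapping $\mathcal{M}$ with convex graph, the coderivative at $(\overline{y},\overline{z})\in\mathrm{gph}\,\mathcal{M}$ is given by $y^*\in D^*\mathcal{M}(\overline{y},\overline{z})(z^* )\iff(y^*,-z^* )\in N((\overline{y},\overline{z});\mathrm{gph}\,\mathcal{M})$.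 The graph of $\mathcal{E}_{\mathcal{F}}$ is convex. The subdifferential of $\mathcal{F}$ at $(\overline{b},\overline{x})\in\mathrm{gph}\,\mathcal{E}_{\mathcal{F}}$ (with respect to the ordering cone $\Theta$) is $$\partial\mathcal{F}(\overline{b},\overline{x}):=\{y: y\in D^*\mathcal{E}_{\mathcal{F}}(\overline{b},\overline{x})(z^* )\ \text{for some } z^*\in\mathbb{R}^n\text{ with }-z^*\in N(0_n;\Theta),\ \|z^*\|_*=1\}.$$
   Formalization: The formal statement adds the hypothesis that gph S is nonempty; without it the identity is false (e.g. n=m=q=1, a_1=0, c_1=1 at (0,0): the left side is empty, the right side is all of R^T), and it fails in every case where gph S is empty. *)

theory Defs
  imports "HOL-Analysis.Analysis"
begin

text \<open>
  The space \<open>\<real>\<^sup>n\<close> carries an arbitrary norm, which need not be the Euclidean norm of the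
  type class. It is therefore passed as a function \<open>nrm\<close>, while duality pairings are
  expressed by the standard inner product.
\<close>

definition is_norm :: "('a::real_vector \<Rightarrow> real) \<Rightarrow> bool" where
  "is_norm nrm \<longleftrightarrow>
     (\<forall>x. 0 \<le> nrm x) \<and>
     (\<forall>x. nrm x = 0 \<longleftrightarrow> x = 0) \<and>
     (\<forall>r x. nrm (r *\<^sub>R x) = \<bar>r\<bar> * nrm x) \<and>
     (\<forall>x y. nrm (x + y) \<le> nrm x + nrm y)"

definition dual_norm :: "('a::real_inner \<Rightarrow> real) \<Rightarrow> 'a \<Rightarrow> real" where
  "dual_norm nrm z = (SUP x\<in>{x. nrm x \<le> 1}. z \<bullet> x)"

definition positive_polar :: "'a::real_inner set \<Rightarrow> 'a set" where
  "positive_polar \<Omega> = {y. \<forall>x\<in>\<Omega>. y \<bullet> x \<ge> 0}"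

definition gph :: "('a \<Rightarrow> 'b set) \<Rightarrow> ('a \<times> 'b) set" where
  "gph M = {(y, z). z \<in> M y}"

text \<open>
  The next two notions are meant for convex sets and for mappings with convex graph,
  respectively, at a point of the set or graph. The inner product on a product space is the
  sum of the componentwise inner products.
\<close>

definition normal_cone :: "'a::real_inner \<Rightarrow> 'a set \<Rightarrow> 'a set" where
  "normal_cone w \<Omega> = {w'. \<forall>v\<in>\<Omega>. w' \<bullet> (v - w) \<le> 0}"

definition coderivative ::
    "('a::real_inner \<Rightarrow> 'b::real_inner set) \<Rightarrow> 'a \<times> 'b \<Rightarrow> 'b \<Rightarrow> 'a set" where
  "coderivative M p z' = {y'. (y', - z') \<in> normal_cone p (gph M)}"

text \<open>The sum in the following definition is the Minkowski sum of sets.\<close>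

definition epigraphical :: "'b::plus set \<Rightarrow> ('a \<Rightarrow> 'b set) \<Rightarrow> 'a \<Rightarrow> 'b set" where
  "epigraphical \<Theta> M y = M y + \<Theta>"

definition subdifferential ::
    "('b::real_inner \<Rightarrow> real) \<Rightarrow> 'b set \<Rightarrow> ('a::real_inner \<Rightarrow> 'b set) \<Rightarrow> 'a \<times> 'b \<Rightarrow> 'a set" where
  "subdifferential nrm \<Theta> M p =
     {y. \<exists>z'. y \<in> coderivative (epigraphical \<Theta> M) p z' \<and>
              - z' \<in> normal_cone 0 \<Theta> \<and> dual_norm nrm z' = 1}"

definition feasible :: "('m::finite \<Rightarrow> real^'n) \<Rightarrow> real^'m \<Rightarrow> (real^'n) set" where
  "feasible a b = {x. \<forall>t. a t \<bullet> x \<le> b $ t}"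

definition nondominated ::
    "('m::finite \<Rightarrow> real^'n) \<Rightarrow> ('q::finite \<Rightarrow> real^'n) \<Rightarrow> real^'m \<Rightarrow> (real^'n) set" where
  "nondominated a c b =
     {x \<in> feasible a b.
        \<not> (\<exists>y \<in> feasible a b. (\<forall>i. c i \<bullet> y \<le> c i \<bullet> x) \<and> (\<exists>i. c i \<bullet> y < c i \<bullet> x))}"

text \<open>
  The graph of \<open>nondominated a c\<close> can be empty although every \<open>feasible a b\<close> with
  nonnegative \<open>b\<close> is nonempty: with one constraint vector \<open>0\<close> and one objective vector
  \<open>1\<close> on the real line, the objective is unbounded below on each nonempty feasible set.
  A description of a set by inequalities over this graph is then vacuous, so such statements
  need nonemptiness of the graph as a hypothesis.
\<close>

definition ordering_cone :: "('q::finite \<Rightarrow> real^'n) \<Rightarrow> (real^'n) set" where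
  "ordering_cone c = positive_polar (range c)"

end

theory Submission
  imports Defs
begin

text \<open>
  Both sides are unions over a vector \<open>v\<close> of dual norm one. On the left \<open>v\<close> ranges over the
  dual cone of the ordering cone \<open>\<Theta>\<close>, on the right over the cone generated by the objectives;
  these cones agree by the bipolar theorem (\<open>positive_polar_positive_polar_finite\<close>), where
  finiteness supplies the closedness of the generated cone. It remains to compare, for fixed
  \<open>v\<close>, one linear inequality on two graphs. Since \<open>v\<close> is nonnegative on \<open>\<Theta>\<close>, its validity
  on the epigraphical graph amounts to its validity on the graph of \<open>feasible a\<close>, which contains
  the graph of \<open>nondominated a c\<close>.

  For the passage back, every feasible point has to be dominated by a nondominated one
  (\<open>ex_nondominated_le\<close>), because replacing a point by a dominating one only decreases
  \<open>v \<bullet> x\<close>. A dominating point that minimizes \<open>\<Sum>i. c i\<close> is nondominated, so a linear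
  program must have a solution. A nondominated point, for whatever right-hand side, shows that
  a direction \<open>d\<close> with \<open>a t \<bullet> d \<le> 0\<close> and \<open>c i \<bullet> d \<le> 0\<close> has \<open>c i \<bullet> d = 0\<close>; hence no
  recession direction of that program decreases the objective.

  That such a program attains its minimum (\<open>linear_program_attains\<close>) follows from the fact that
  the right-hand sides with nonempty feasible set form a closed cone
  (\<open>closed_feasible_right_hand_sides\<close>). When the objective is treated as one more
  constraint, closedness gives both the boundedness of the values, by a scaling argument, and
  their attainment.
\<close>

section \<open>Solvability of linear programs\<close>

lemma convex_cone_sum:
  assumes "convex_cone K" "\<And>i. i \<in> A \<Longrightarrow> f i \<in> K"
  shows "sum f A \<in> K"
  using assms(2)
  by (induction A rule: infinite_finite_induct)
    (auto simp: convex_cone_contains_0[OF assms(1)] intro: convex_cone_add[OF assms(1)])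

text \<open>
  The set below is the sum of the range of \<open>x \<mapsto> (g t \<bullet> x)\<^sub>t\<close> and the nonnegative
  orthant. It is therefore generated as a cone by the images of the signed unit vectors and the
  unit vectors of \<open>\<real>\<^sup>k\<close>, and finitely generated cones are closed.
\<close>

lemma closed_feasible_right_hand_sides:
  fixes g :: "'k::finite \<Rightarrow> real^'n"
  shows "closed {b. feasible g b \<noteq> {}}"
proof -
  define L where "L x = (\<chi> t. g t \<bullet> x)" for x :: "real^'n"
  have L: "linear L"
    by (rule linearI) (auto simp: L_def vec_eq_iff inner_right_distrib)
  define D where "D = {b. feasible g b \<noteq> {}}"
  have D_iff: "b \<in> D \<longleftrightarrow> (\<exists>x. \<forall>t. g t \<bullet> x \<le> b $ t)" for b
    by (auto simp: D_def feasible_def)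
  define G where "G = L ` Basis \<union> (\<lambda>e. - L e) ` Basis \<union> range (\<lambda>t. axis t 1)"
  have "D = convex_cone hull G"
  proof
    show "convex_cone hull G \<subseteq> D"
    proof (rule hull_minimal)
      show "G \<subseteq> D"
      proof
        fix u assume "u \<in> G"
        then consider e where "u = L e" | t where "u = axis t 1"
          by (auto simp: G_def linear_neg[OF L, symmetric])
        then show "u \<in> D"
        proof cases
          case 1
          then show ?thesis
            by (auto simp: D_iff L_def)
        next
          case 2
          then show ?thesis
            unfolding D_iff by (intro exI[of _ 0]) (auto simp: axis_def)
        qed
      qed
      show "convex_cone D"
        unfolding convex_cone_iff
      proof (intro conjI ballI allI impI)
        show "0 \<in> D"
          unfolding D_iff by (intro exI[of _ 0]) auto
      next
        fix u w assume "u \<in> D" "w \<in> D"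
        then obtain x y where "\<forall>t. g t \<bullet> x \<le> u $ t" "\<forall>t. g t \<bullet> y \<le> w $ t"
          unfolding D_iff by blast
        then show "u + w \<in> D"
          unfolding D_iff
          by (intro exI[of _ "x + y"]) (auto simp: inner_right_distrib intro: add_mono)
      next
        fix u and r :: real assume "u \<in> D" "0 \<le> r"
        then obtain x where "\<forall>t. g t \<bullet> x \<le> u $ t"
          unfolding D_iff by blast
        then show "r *\<^sub>R u \<in> D"
          unfolding D_iff using \<open>0 \<le> r\<close>
          by (intro exI[of _ "r *\<^sub>R x"]) (auto intro: mult_left_mono)
      qed
    qed
    show "D \<subseteq> convex_cone hull G"
    proof
      fix b assume "b \<in> D"
      then obtain x where x: "\<And>t. g t \<bullet> x \<le> b $ t"
        unfolding D_iff by blast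
      have "(x \<bullet> e) *\<^sub>R L e \<in> convex_cone hull G" if "e \<in> Basis" for e
      proof (cases "0 \<le> x \<bullet> e")
        case True
        then show ?thesis
          using that by (intro convex_cone_hull_mul hull_inc) (auto simp: G_def)
      next
        case False
        then have "(- (x \<bullet> e)) *\<^sub>R (- L e) \<in> convex_cone hull G"
          using that by (intro convex_cone_hull_mul hull_inc) (auto simp: G_def)
        then show ?thesis by simp
      qed
      then have "(\<Sum>e\<in>Basis. (x \<bullet> e) *\<^sub>R L e) \<in> convex_cone hull G"
        by (intro convex_cone_sum convex_cone_convex_cone_hull)
      also have "(\<Sum>e\<in>Basis. (x \<bullet> e) *\<^sub>R L e) = L (\<Sum>e\<in>Basis. (x \<bullet> e) *\<^sub>R e)"
        by (simp add: linear_sum[OF L] linear_cmul[OF L])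
      finally have Lx: "L x \<in> convex_cone hull G"
        by (simp add: euclidean_representation)
      have "(b - L x) $ t *\<^sub>R axis t 1 \<in> convex_cone hull G" for t
        using x[of t] by (intro convex_cone_hull_mul hull_inc) (auto simp: G_def L_def)
      then have "(\<Sum>t\<in>UNIV. (b - L x) $ t *\<^sub>R axis t 1) \<in> convex_cone hull G"
        by (intro convex_cone_sum convex_cone_convex_cone_hull)
      also have "(\<Sum>t\<in>UNIV. (b - L x) $ t *\<^sub>R axis t 1) = b - L x"
        using basis_expansion[of "b - L x"] by (simp add: scalar_mult_eq_scaleR)
      finally show "b \<in> convex_cone hull G"
        using convex_cone_hull_add[OF Lx] by fastforce
    qed
  qed
  moreover have "finite G"
    by (simp add: G_def)
  ultimately show ?thesis
    using closed_convex_cone_hull unfolding D_def by metis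
qed

text \<open>
  The objective becomes a constraint \<open>h \<bullet> x \<le> r\<close>, and \<open>R\<close> collects the values \<open>r\<close> for which
  the enlarged system is solvable; it is closed. If \<open>R\<close> were unbounded below, dividing solvable
  systems with \<open>r = -n\<close> by \<open>n\<close> would produce, in the limit, a solution \<open>d\<close> of
  \<open>g t \<bullet> d \<le> 0\<close> and \<open>h \<bullet> d \<le> -1\<close>, against the recession hypothesis.
\<close>

lemma linear_program_attains:
  fixes g :: "'k::finite \<Rightarrow> real^'n"
  assumes ne: "feasible g b \<noteq> {}"
    and recession: "\<And>d. (\<And>t. g t \<bullet> d \<le> 0) \<Longrightarrow> 0 \<le> h \<bullet> d"
  obtains x where "x \<in> feasible g b" "\<And>y. y \<in> feasible g b \<Longrightarrow> h \<bullet> x \<le> h \<bullet> y"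
proof -
  define gh where "gh = case_option h g"
  define rhs :: "real \<Rightarrow> real^'k \<Rightarrow> real^('k option)"
    where "rhs r u = (\<chi> s. case s of None \<Rightarrow> r | Some t \<Rightarrow> u $ t)" for r u
  have feasible_iff: "x \<in> feasible gh (rhs r u) \<longleftrightarrow> h \<bullet> x \<le> r \<and> x \<in> feasible g u" for x r u
    by (simp add: feasible_def gh_def rhs_def split_option_all)
  define D where "D = {u. feasible gh u \<noteq> {}}"
  have closed_D: "closed D"
    unfolding D_def by (rule closed_feasible_right_hand_sides)
  define R where "R = {r. rhs r b \<in> D}"
  have R_iff: "r \<in> R \<longleftrightarrow> (\<exists>x \<in> feasible g b. h \<bullet> x \<le> r)" for r
    unfolding R_def D_def using feasible_iff by blast
  have "continuous_on UNIV (\<lambda>r. rhs r b)"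
    unfolding rhs_def
  proof (rule continuous_on_vec_lambda)
    show "continuous_on UNIV (\<lambda>r. case s of None \<Rightarrow> r | Some t \<Rightarrow> b $ t)" for s
      by (cases s) auto
  qed
  then have "closed ((\<lambda>r. rhs r b) -` D)"
    using closed_D by (simp add: closed_vimage)
  then have closed_R: "closed R"
    by (simp add: R_def vimage_def)
  have bdd: "bdd_below R"
  proof (rule ccontr)
    assume unbdd: "\<not> bdd_below R"
    have "rhs (-1) ((1 / real (Suc n)) *\<^sub>R b) \<in> D" for n
    proof -
      obtain r where "r \<in> R" "r < - real (Suc n)"
        using unbdd by (meson bdd_below.I not_le)
      then obtain x where x: "x \<in> feasible g b" "h \<bullet> x \<le> - real (Suc n)"
        unfolding R_iff by fastforce
      have "h \<bullet> ((1 / real (Suc n)) *\<^sub>R x) \<le> -1"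
        using x(2) by (simp add: divide_le_eq del: of_nat_Suc)
      moreover have "(1 / real (Suc n)) *\<^sub>R x \<in> feasible g ((1 / real (Suc n)) *\<^sub>R b)"
        using x(1) by (simp add: feasible_def divide_right_mono del: of_nat_Suc)
      ultimately show ?thesis
        unfolding D_def using feasible_iff by blast
    qed
    moreover have "(\<lambda>n. rhs (-1) ((1 / real (Suc n)) *\<^sub>R b)) \<longlonglongrightarrow> rhs (-1) 0"
    proof (rule vec_tendstoI)
      fix s
      have "(\<lambda>n. (1 / real (Suc n)) * b $ t) \<longlonglongrightarrow> 0 * b $ t" for t
        using LIMSEQ_inverse_real_of_nat
        by (intro tendsto_mult tendsto_const) (simp add: inverse_eq_divide)
      then show "(\<lambda>n. rhs (-1) ((1 / real (Suc n)) *\<^sub>R b) $ s) \<longlonglongrightarrow> rhs (-1) 0 $ s"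
        by (cases s) (auto simp: rhs_def)
    qed
    ultimately have "rhs (-1) 0 \<in> D"
      by (rule closed_sequentially[OF closed_D])
    then obtain d where "h \<bullet> d \<le> -1" "d \<in> feasible g 0"
      unfolding D_def using feasible_iff by blast
    then show False
      using recession[of d] by (simp add: feasible_def)
  qed
  have "R \<noteq> {}"
    using ne R_iff by blast
  then have "Inf R \<in> R"
    by (intro closed_contains_Inf bdd closed_R)
  then obtain x where x: "x \<in> feasible g b" "h \<bullet> x \<le> Inf R"
    unfolding R_iff by blast
  have "h \<bullet> x \<le> h \<bullet> y" if "y \<in> feasible g b" for y
  proof -
    have "h \<bullet> y \<in> R"
      using that R_iff by blast
    then show ?thesis
      using x(2) cInf_lower[OF _ bdd] by fastforce
  qed
  then show ?thesis
    using that x(1) by blast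
qed

section \<open>External stability\<close>

text \<open>
  Moving from a nondominated point in the direction \<open>d\<close> preserves feasibility, so a strict
  decrease of one objective would contradict nondominatedness.
\<close>

lemma nondominated_recession:
  assumes x: "x \<in> nondominated a c b"
    and ad: "\<And>t. a t \<bullet> d \<le> 0" and cd: "\<And>i. c i \<bullet> d \<le> 0"
  shows "c i \<bullet> d = 0"
proof -
  have "x + d \<in> feasible a b"
    using x add_mono[OF _ ad] by (fastforce simp: nondominated_def feasible_def inner_right_distrib)
  moreover have "\<forall>i. c i \<bullet> (x + d) \<le> c i \<bullet> x"
    using cd by (simp add: inner_right_distrib)
  ultimately have "\<not> c i \<bullet> (x + d) < c i \<bullet> x"
    using x unfolding nondominated_def by blast
  then show ?thesis
    using cd[of i] by (simp add: inner_right_distrib)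
qed

text \<open>
  A minimizer of \<open>\<Sum>i. c i\<close> among the feasible points that are at least as good as \<open>x\<close> is
  nondominated: a point dominating it would belong to the same set and have a smaller sum.
\<close>

lemma ex_nondominated_le:
  fixes a :: "'m::finite \<Rightarrow> real^'n" and c :: "'q::finite \<Rightarrow> real^'n"
  assumes graph: "gph (nondominated a c) \<noteq> {}" and x: "x \<in> feasible a b"
  obtains x' where "x' \<in> nondominated a c b" "\<And>i. c i \<bullet> x' \<le> c i \<bullet> x"
proof -
  obtain b0 x0 where x0: "x0 \<in> nondominated a c b0"
    using graph by (auto simp: gph_def)
  define g where "g = case_sum a c"
  define u :: "real^('m + 'q)" where "u = (\<chi> s. case s of Inl t \<Rightarrow> b $ t | Inr i \<Rightarrow> c i \<bullet> x)"
  have feasible_iff: "y \<in> feasible g u \<longleftrightarrow> y \<in> feasible a b \<and> (\<forall>i. c i \<bullet> y \<le> c i \<bullet> x)" for y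
    by (simp add: feasible_def g_def u_def split_sum_all)
  have ne: "feasible g u \<noteq> {}"
    using feasible_iff x by blast
  have recession: "0 \<le> (\<Sum>i\<in>UNIV. c i) \<bullet> d" if d: "\<And>s. g s \<bullet> d \<le> 0" for d
  proof -
    have "c i \<bullet> d = 0" for i
    proof (rule nondominated_recession[OF x0])
      show "a t \<bullet> d \<le> 0" for t
        using d[of "Inl t"] by (simp add: g_def)
      show "c j \<bullet> d \<le> 0" for j
        using d[of "Inr j"] by (simp add: g_def)
    qed
    then show ?thesis
      by (simp add: inner_sum_left)
  qed
  obtain x' where x': "x' \<in> feasible g u"
    and min: "\<And>y. y \<in> feasible g u \<Longrightarrow> (\<Sum>i\<in>UNIV. c i) \<bullet> x' \<le> (\<Sum>i\<in>UNIV. c i) \<bullet> y"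
    using linear_program_attains[OF ne recession] by blast
  have "x' \<in> nondominated a c b"
    unfolding nondominated_def
  proof (safe)
    show "x' \<in> feasible a b"
      using x' feasible_iff by blast
  next
    fix y i
    assume y: "y \<in> feasible a b" "\<forall>i. c i \<bullet> y \<le> c i \<bullet> x'" and i: "c i \<bullet> y < c i \<bullet> x'"
    have "y \<in> feasible g u"
      using y x' feasible_iff by (meson order_trans)
    then have "(\<Sum>i\<in>UNIV. c i \<bullet> x') \<le> (\<Sum>i\<in>UNIV. c i \<bullet> y)"
      using min by (simp add: inner_sum_left)
    moreover have "(\<Sum>i\<in>UNIV. c i \<bullet> y) < (\<Sum>i\<in>UNIV. c i \<bullet> x')"
      by (rule sum_strict_mono_ex1) (use y(2) i in auto)
    ultimately show False
      by simp
  qed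
  then show ?thesis
    using that x' feasible_iff by blast
qed

section \<open>The dual of the ordering cone\<close>

text \<open>
  A vector outside the closed cone generated by a finite set is separated from it by a hyperplane;
  by conicity the hyperplane can be taken through the origin, so its normal lies in the polar.
\<close>

lemma positive_polar_positive_polar_finite:
  fixes S :: "'a::euclidean_space set"
  assumes "finite S"
  shows "positive_polar (positive_polar S) = convex_cone hull S"
proof
  have "convex_cone (positive_polar (positive_polar S))"
    by (auto simp: convex_cone_iff positive_polar_def inner_add_left)
  moreover have "S \<subseteq> positive_polar (positive_polar S)"
    by (auto simp: positive_polar_def inner_commute)
  ultimately show "convex_cone hull S \<subseteq> positive_polar (positive_polar S)"
    by (simp add: hull_minimal)
  show "positive_polar (positive_polar S) \<subseteq> convex_cone hull S"
  proof (rule ccontr)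
    assume "\<not> ?thesis"
    then obtain z where z: "z \<in> positive_polar (positive_polar S)" "z \<notin> convex_cone hull S"
      by blast
    obtain n \<beta> where n: "n \<bullet> z < \<beta>" "\<And>x. x \<in> convex_cone hull S \<Longrightarrow> \<beta> < n \<bullet> x"
      using separating_hyperplane_closed_point[OF convex_convex_cone_hull
          closed_convex_cone_hull[OF assms] z(2)] by blast
    have "\<beta> < 0"
      using n(2)[OF convex_cone_hull_contains_0] by simp
    have "0 \<le> n \<bullet> x" if "x \<in> S" for x
    proof (rule ccontr)
      assume neg: "\<not> 0 \<le> n \<bullet> x"
      \<comment> \<open>This multiple of \<open>x\<close> lies exactly on the separating hyperplane.\<close>
      have "(\<beta> / (n \<bullet> x)) *\<^sub>R x \<in> convex_cone hull S"
        using that neg \<open>\<beta> < 0\<close>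
        by (intro convex_cone_hull_mul hull_inc) (auto simp: divide_nonpos_nonpos)
      then show False
        using n(2) neg by fastforce
    qed
    then have "n \<in> positive_polar S"
      by (simp add: positive_polar_def)
    then have "0 \<le> z \<bullet> n"
      using z(1) by (simp add: positive_polar_def)
    then show False
      using n(1) \<open>\<beta> < 0\<close> by (simp add: inner_commute)
  qed
qed

lemma neg_normal_cone_0_iff: "- z \<in> normal_cone 0 \<Theta> \<longleftrightarrow> z \<in> positive_polar \<Theta>"
  by (auto simp: normal_cone_def positive_polar_def)

section \<open>The subdifferential\<close>

lemma mem_subdifferential_iff:
  "y \<in> subdifferential nrm \<Theta> M (b0, x0) \<longleftrightarrow>
    (\<exists>v \<in> positive_polar \<Theta>. dual_norm nrm v = 1 \<and>
      (\<forall>(b, x) \<in> gph (epigraphical \<Theta> M). y \<bullet> (b - b0) \<le> v \<bullet> (x - x0)))"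
proof -
  have "(y, - v) \<in> normal_cone (b0, x0) (gph (epigraphical \<Theta> M)) \<longleftrightarrow>
      (\<forall>(b, x) \<in> gph (epigraphical \<Theta> M). y \<bullet> (b - b0) \<le> v \<bullet> (x - x0))" for v
    by (auto simp: normal_cone_def)
  then show ?thesis
    unfolding subdifferential_def coderivative_def neg_normal_cone_0_iff by blast
qed

text \<open>
  Both steps from the epigraphical graph to the graph of \<open>nondominated a c\<close>, removing the
  summand from the ordering cone and passing to a dominating point, replace \<open>x\<close> by some \<open>x'\<close>
  with \<open>c i \<bullet> x' \<le> c i \<bullet> x\<close> for all \<open>i\<close>, hence with \<open>v \<bullet> x' \<le> v \<bullet> x\<close>, and keep \<open>b\<close>.
\<close>

lemma inequality_epigraphical_iff_nondominated:
  fixes a :: "'m::finite \<Rightarrow> real^'n" and c :: "'q::finite \<Rightarrow> real^'n"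
  assumes graph: "gph (nondominated a c) \<noteq> {}"
    and v: "v \<in> positive_polar (ordering_cone c)"
  shows "(\<forall>(b, x) \<in> gph (epigraphical (ordering_cone c) (feasible a)).
            y \<bullet> (b - b0) \<le> v \<bullet> (x - x0)) \<longleftrightarrow>
         (\<forall>(b, x) \<in> gph (nondominated a c). y \<bullet> (b - b0) \<le> v \<bullet> (x - x0))"
    (is "?epi \<longleftrightarrow> ?nondom")
proof
  assume epi: ?epi
  have "0 \<in> ordering_cone c"
    by (simp add: ordering_cone_def positive_polar_def)
  then have "x \<in> epigraphical (ordering_cone c) (feasible a) b" if "x \<in> nondominated a c b" for b x
    using that set_plus_intro[of x "feasible a b" 0]
    by (simp add: epigraphical_def nondominated_def)
  then show ?nondom
    using epi by (auto simp: gph_def)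
next
  assume nondom: ?nondom
  show ?epi
  proof safe
    fix b x
    assume "(b, x) \<in> gph (epigraphical (ordering_cone c) (feasible a))"
    then obtain z \<theta> where z: "z \<in> feasible a b" and \<theta>: "\<theta> \<in> ordering_cone c" and x: "x = z + \<theta>"
      by (auto simp: gph_def epigraphical_def set_plus_def)
    obtain x' where x': "x' \<in> nondominated a c b" "\<And>i. c i \<bullet> x' \<le> c i \<bullet> z"
      using ex_nondominated_le[OF graph z] by blast
    have "x - x' \<in> ordering_cone c"
      unfolding ordering_cone_def positive_polar_def
    proof (intro CollectI ballI)
      fix w assume "w \<in> range c"
      then obtain i where w: "w = c i"
        by blast
      have "0 \<le> c i \<bullet> \<theta>"
        using \<theta> by (auto simp: ordering_cone_def positive_polar_def inner_commute)
      then show "0 \<le> (x - x') \<bullet> w"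
        using x'(2)[of i] by (simp add: w x inner_commute[of _ "c i"] inner_diff_right inner_add_right)
    qed
    then have "v \<bullet> x' \<le> v \<bullet> x"
      using v by (fastforce simp: positive_polar_def inner_diff_right)
    moreover have "y \<bullet> (b - b0) \<le> v \<bullet> (x' - x0)"
      using nondom x'(1) by (auto simp: gph_def)
    ultimately show "y \<bullet> (b - b0) \<le> v \<bullet> (x - x0)"
      by (simp add: inner_diff_right)
  qed
qed

theorem theorem2:
  fixes nrm :: "real^'n \<Rightarrow> real"
    and a :: "'m::finite \<Rightarrow> real^'n"
    and c :: "'q::finite \<Rightarrow> real^'n"
    and bbar :: "real^'m" and xbar :: "real^'n"
  assumes "is_norm nrm"
    and "gph (nondominated a c) \<noteq> {}"
    and "(bbar, xbar) \<in> gph (epigraphical (ordering_cone c) (feasible a))"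
  shows "subdifferential nrm (ordering_cone c) (feasible a) (bbar, xbar) =
    (\<Union>v \<in> {v \<in> convex_cone hull (range c). dual_norm nrm v = 1}.
       {y. \<forall>(b, x) \<in> gph (nondominated a c). y \<bullet> (b - bbar) \<le> v \<bullet> (x - xbar)})"
proof (rule set_eqI)
  fix y
  have polar: "positive_polar (ordering_cone c) = convex_cone hull (range c)"
    by (simp add: ordering_cone_def positive_polar_positive_polar_finite)
  have "y \<in> subdifferential nrm (ordering_cone c) (feasible a) (bbar, xbar) \<longleftrightarrow>
      (\<exists>v \<in> positive_polar (ordering_cone c). dual_norm nrm v = 1 \<and>
        (\<forall>(b, x) \<in> gph (nondominated a c). y \<bullet> (b - bbar) \<le> v \<bullet> (x - xbar)))"
    unfolding mem_subdifferential_iff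
    by (intro bex_cong refl conj_cong inequality_epigraphical_iff_nondominated assms(2))
  then show "y \<in> subdifferential nrm (ordering_cone c) (feasible a) (bbar, xbar) \<longleftrightarrow>
      y \<in> (\<Union>v \<in> {v \<in> convex_cone hull (range c). dual_norm nrm v = 1}.
        {y. \<forall>(b, x) \<in> gph (nondominated a c). y \<bullet> (b - bbar) \<le> v \<bullet> (x - xbar)})"
    unfolding polar by blast
qed

end
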